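(* Let $\mathcal{H}$ be a real Hilbert space, let $f:\mathcal{H}\to\mathbb{R}\cup\{+\infty\}$ be proper, convex and lower semicontinuous, and let $g:\mathcal{H}\to\mathbb{R}$ be convex and continuously Fréchet differentiable with $L$-Lipschitz continuous gradient ($L>0$). Assume $\operatorname{argmin}(f+g)\neq\emptyset$. Let $(t_k)_{k\ge0}$ be a real sequence with $t_0=1$ and $$t_{k-1}<t_k<\frac{1+\sqrt{1+4t_{k-1}^2}}{2}\quad\text{for all }k\ge1,$$ let $(\varepsilon_k)_{k\ge1}$ be a non-increasing sequence of positive reals with $\lim_{k\to+\infty}\varepsilon_k=0$, and let $0<s<\frac1L$. Let $x_0,x_1\in\mathcal{H}$ and for all $k\ge1$ set $$y_k= x_k+\frac{(t_{k}-1)(t_{k-1}-1)}{t_{k-1}^2}(x_k-x_{k-1})-\frac{-t_{k}^2+t_{k}+t_{k-1}^2}{t_{k-1}^2t_{k}}\, x_k,\qquad x_{k+1}=\operatorname{prox}_{sf}\left(y_k-s\nabla g(y_k)-s\varepsilon_k y_k\right).$$ Let $k_0\ge1$ be an integer such that $s\in\left(0,\frac{1}{L+\varepsilon_{k_0}}\right]$, and for $k\ge k_0$ put $$\alpha_k=\frac{-t_k^2+t_k+t_{k-1}^2}{t_{k-1}^2},\qquad \pi_k=\frac{1}{\prod_{i=k_0}^k(1-\alpha_i)}.$$ Assume that one of the following two sets of conditions holds: (a) $\lim_{k\to+\infty}\pi_k=+\infty$, $\ \limsup_{k\to+\infty}\frac{t_k^2(\varepsilon_k-\varepsilon_{k+1})}{\alpha_k}<+\infty$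 and $\limsup_{k\to+\infty}\frac{t_k\varepsilon_k}{\alpha_k}<+\infty$; (b) $\lim_{k\to+\infty}\pi_k<+\infty$, $\ \sum_{k=1}^{+\infty}t_k^2(\varepsilon_k-\varepsilon_{k+1})<+\infty$ and $\sum_{k=1}^{+\infty}t_k\varepsilon_k<+\infty$. Then, as $k\to+\infty$, $$F_k(x_k)-F_k(\overline{x}_k)=\mathcal{O}\left(\frac{1}{t_{k-1}^2}\right),$$ where $F_k(x)=f(x)+g(x)+\frac{\varepsilon_k}{2}\|x\|^2$ and $\overline{x}_k$ is the unique minimizer of $F_k$, and $$(f+g)(x_k)-\min(f+g)=\mathcal{O}\left(\frac{1}{t_{k-1}^2}\right)+\mathcal{O}(\varepsilon_k).$$
   Context: For $s>0$, $\operatorname{prox}_{sf}(x)=\operatorname{argmin}_{y\in\mathcal{H}}\left\{f(y)+\frac{1}{2s}\|y-x\|^2\right\}$. Under the stated conditions on $(t_k)$ one has $0<\alpha_k<1$ for all $k\ge1$, so $(\pi_k)$ is well defined and increasing. *)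

theory Defs
  imports "HOL-Analysis.Analysis" "HOL-Library.Landau_Symbols"
begin

text \<open>Functions with values in \<open>\<real> \<union> {+\<infinity>}\<close> are rendered as \<^typ>\<open>ereal\<close>-valued functions;
  \<open>proper\<close> excludes the value \<open>-\<infinity>\<close>.\<close>

definition proper :: "('a \<Rightarrow> ereal) \<Rightarrow> bool" where
  "proper f \<longleftrightarrow> (\<forall>x. f x \<noteq> -\<infinity>) \<and> (\<exists>x. f x \<noteq> \<infinity>)"

text \<open>At the weights 0 and 1 the inequality holds trivially, since \<open>0 * \<infinity> = 0\<close> in \<^typ>\<open>ereal\<close>.\<close>

definition ereal_convex :: "('a::real_vector \<Rightarrow> ereal) \<Rightarrow> bool" where
  "ereal_convex f \<longleftrightarrow>
     (\<forall>x y. \<forall>u\<in>{0<..<1::real}.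
        f ((1 - u) *\<^sub>R x + u *\<^sub>R y) \<le> ereal (1 - u) * f x + ereal u * f y)"

definition lower_semicontinuous :: "('a::topological_space \<Rightarrow> ereal) \<Rightarrow> bool" where
  "lower_semicontinuous f \<longleftrightarrow> (\<forall>x. f x \<le> Liminf (at x) f)"

definition argmin :: "('a \<Rightarrow> ereal) \<Rightarrow> 'a set" where
  "argmin h = {x. is_arg_min h (\<lambda>_. True) x}"

text \<open>For \<open>f\<close> proper, convex and lower semicontinuous and \<open>s > 0\<close> on a Hilbert space, the set of
  minimizers below is a singleton; \<open>prox s f x\<close> stands for \<open>prox\<^bsub>s f\<^esub>(x)\<close>.\<close>

definition prox :: "real \<Rightarrow> ('a::real_inner \<Rightarrow> ereal) \<Rightarrow> 'a \<Rightarrow> 'a" where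
  "prox s f x = the_elem (argmin (\<lambda>y. f y + ereal (1 / (2 * s) * (norm (y - x))\<^sup>2)))"

definition objective :: "('a \<Rightarrow> ereal) \<Rightarrow> ('a \<Rightarrow> real) \<Rightarrow> 'a \<Rightarrow> ereal" where
  "objective f g x = f x + ereal (g x)"

definition reg_objective ::
    "('a::real_inner \<Rightarrow> ereal) \<Rightarrow> ('a \<Rightarrow> real) \<Rightarrow> (nat \<Rightarrow> real) \<Rightarrow> nat \<Rightarrow> 'a \<Rightarrow> ereal" where
  "reg_objective f g \<epsilon> k x = objective f g x + ereal (\<epsilon> k / 2 * (norm x)\<^sup>2)"

text \<open>\<open>\<epsilon> k > 0\<close> makes the regularized objective strongly convex, so that its set of minimizers is a
  singleton.\<close>

definition reg_minimizer ::
    "('a::real_inner \<Rightarrow> ereal) \<Rightarrow> ('a \<Rightarrow> real) \<Rightarrow> (nat \<Rightarrow> real) \<Rightarrow> nat \<Rightarrow> 'a" where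
  "reg_minimizer f g \<epsilon> k = the_elem (argmin (reg_objective f g \<epsilon> k))"

definition alpha_seq :: "(nat \<Rightarrow> real) \<Rightarrow> nat \<Rightarrow> real" where
  "alpha_seq t k = (- (t k)\<^sup>2 + t k + (t (k - 1))\<^sup>2) / (t (k - 1))\<^sup>2"

definition pi_seq :: "(nat \<Rightarrow> real) \<Rightarrow> nat \<Rightarrow> nat \<Rightarrow> real" where
  "pi_seq t k0 k = 1 / (\<Prod>i = k0..k. 1 - alpha_seq t i)"

end

theory Submission
  imports Defs
begin

text \<open>
  Fix a minimizer \<open>w\<close> of \<open>f + g\<close> and put \<open>z\<^sub>k = x\<^sub>k\<^sub>-\<^sub>1 + t\<^sub>k\<^sub>-\<^sub>1 (x\<^sub>k - x\<^sub>k\<^sub>-\<^sub>1)\<close>. Then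
  \<open>t\<^sub>k y\<^sub>k = (t\<^sub>k - 1) x\<^sub>k + (1 - \<alpha>\<^sub>k) z\<^sub>k\<close>, and the forward-backward inequality for \<open>F\<^sub>k\<close>, tested at
  \<open>(1 - 1/t\<^sub>k) x\<^sub>k + w/t\<^sub>k\<close>, shows that the energy
  \<open>E\<^sub>k = t\<^sub>k\<^sub>-\<^sub>1\<^sup>2 (F\<^sub>k(x\<^sub>k) - F\<^sub>k(w)) + |z\<^sub>k - w|\<^sup>2/(2s)\<close> satisfies
  \<open>E\<^sub>k\<^sub>+\<^sub>1 \<le> (1 - \<alpha>\<^sub>k) E\<^sub>k + \<alpha>\<^sub>k |w|\<^sup>2/(2s) + t\<^sub>k\<^sup>2 (\<epsilon>\<^sub>k - \<epsilon>\<^sub>k\<^sub>+\<^sub>1) |w|\<^sup>2/2\<close>.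
  Similarly \<open>t\<^sub>k\<^sup>2 \<epsilon>\<^sub>k \<le> (1 - \<alpha>\<^sub>k) t\<^sub>k\<^sub>-\<^sub>1\<^sup>2 \<epsilon>\<^sub>k\<^sub>-\<^sub>1 + t\<^sub>k \<epsilon>\<^sub>k\<close>. In both cases (a) and (b) the perturbation terms are
  at most a multiple of \<open>\<alpha>\<^sub>k\<close> plus a summable sequence, so \<open>E\<^sub>k\<close> and \<open>t\<^sub>k\<^sup>2 \<epsilon>\<^sub>k\<close> are bounded above.
  Since \<open>F\<^sub>k(w) \<le> min F\<^sub>k + \<epsilon>\<^sub>k |w|\<^sup>2/2\<close>, both estimates follow, the second one even without the
  \<open>O(\<epsilon>\<^sub>k)\<close> term.
\<close>

section \<open>Existence and uniqueness of minimizers\<close>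

text \<open>Every \<open>c\<close> below \<open>f p\<close> is eventually below
  \<open>f (X n)\<close>, hence at most the limit. This is the form in which lower semicontinuity
  enters the direct method.\<close>

lemma lower_semicontinuous_le_lim:
  fixes f :: "'a::topological_space \<Rightarrow> ereal"
  assumes f: "lower_semicontinuous f" and X: "X \<longlonglongrightarrow> p" and l: "(\<lambda>n. f (X n)) \<longlonglongrightarrow> l"
  shows "f p \<le> l"
proof (rule dense_le)
  fix c assume c: "c < f p"
  also have "f p \<le> Liminf (at p) f"
    using f by (simp add: lower_semicontinuous_def)
  finally have "\<forall>\<^sub>F z in at p. c < f z"
    by (rule less_LiminfD)
  \<comment> \<open>\<open>Liminf (at p)\<close> ignores the point itself; \<open>c < f p\<close>
    covers the indices with \<open>X n = p\<close>.\<close>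
  with c have "\<forall>\<^sub>F z in nhds p. c < f z"
    by (auto simp: eventually_at_filter elim: eventually_mono)
  with X have "\<forall>\<^sub>F n in sequentially. c < f (X n)"
    unfolding filterlim_iff by blast
  then have "\<forall>\<^sub>F n in sequentially. c \<le> f (X n)"
    by (auto elim: eventually_mono)
  then show "c \<le> l"
    using l by (intro tendsto_lowerbound) auto
qed

lemma ereal_convexD:
  assumes "ereal_convex f" "f u = ereal a" "f v = ereal b" "0 < \<theta>" "\<theta> < 1"
  shows "f ((1 - \<theta>) *\<^sub>R u + \<theta> *\<^sub>R v) \<le> ereal ((1 - \<theta>) * a + \<theta> * b)"
proof -
  have "f ((1 - \<theta>) *\<^sub>R u + \<theta> *\<^sub>R v) \<le> ereal (1 - \<theta>) * f u + ereal \<theta> * f v"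
    using assms(1,4,5) unfolding ereal_convex_def by simp
  then show ?thesis using assms by simp
qed

lemma argmin_iff: "p \<in> argmin h \<longleftrightarrow> (\<forall>z. h p \<le> h z)"
  by (auto simp: argmin_def is_arg_min_def not_less)

text \<open>Direct method without weak compactness: midpoint strong convexity of \<open>q\<close>
  makes every minimizing sequence Cauchy, completeness gives a limit, and lower semicontinuity makes
  the limit a minimizer. The same midpoint estimate gives uniqueness.\<close>

lemma singleton_argmin_strongly_convex:
  fixes f :: "'a::{real_inner, complete_space} \<Rightarrow> ereal" and q :: "'a \<Rightarrow> real"
  assumes f: "proper f" "ereal_convex f" "lower_semicontinuous f"
    and q: "continuous_on UNIV q"
    and c: "c > 0" "\<And>u v. q ((1/2) *\<^sub>R u + (1/2) *\<^sub>R v) \<le> (q u + q v) / 2 - c * (norm (u - v))\<^sup>2"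
    and below: "\<And>z. ereal m \<le> f z + ereal (q z)"
  obtains p where "argmin (\<lambda>z. f z + ereal (q z)) = {p}"
proof -
  define h where "h = (\<lambda>z. f z + ereal (q z))"
  define I where "I = (INF z. h z)"
  have "\<exists>z. h z < \<infinity>"
    using f(1) by (auto simp: proper_def h_def)
  moreover have "ereal m \<le> I"
    unfolding I_def h_def by (intro INF_greatest below)
  ultimately have "\<exists>i. I = ereal i"
    using INF_lower[of _ UNIV h] unfolding I_def[symmetric]
    by (cases I) (auto dest: leD)
  then obtain i where i: "I = ereal i" ..
  have fin: "f z = ereal (real_of_ereal (f z))" if "h z < \<infinity>" for z
    using that f(1) by (cases "f z") (auto simp: h_def proper_def)
  have ge: "i \<le> real_of_ereal (f z) + q z" if "h z < \<infinity>" for z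
  proof -
    have "I \<le> h z" unfolding I_def by (rule INF_lower) simp
    also have "h z = ereal (real_of_ereal (f z) + q z)"
      using fin[OF that] unfolding h_def by (metis plus_ereal.simps(1))
    finally show ?thesis using i by simp
  qed
  \<comment> \<open>Comparing the infimum with the value at the midpoint turns closeness of two
    values to \<open>i\<close> into closeness of the points.\<close>
  have mid: "c * (norm (u - v))\<^sup>2 \<le> (a + b) / 2 - i"
    if u: "h u = ereal a" and v: "h v = ereal b" for u v a b
  proof -
    obtain a' where a': "f u = ereal a'" using fin[of u] u by auto
    obtain b' where b': "f v = ereal b'" using fin[of v] v by auto
    have "I \<le> h ((1/2) *\<^sub>R u + (1/2) *\<^sub>R v)"
      unfolding I_def by (rule INF_lower) simp
    also have "\<dots> \<le> ereal ((a' + b') / 2) + ereal (q ((1/2) *\<^sub>R u + (1/2) *\<^sub>R v))"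
      unfolding h_def using ereal_convexD[OF f(2) a' b', of "1/2"]
      by (intro add_right_mono) (simp add: field_simps)
    finally have "i \<le> (a' + b') / 2 + q ((1/2) *\<^sub>R u + (1/2) *\<^sub>R v)"
      using i by simp
    then show ?thesis
      using c(2)[of u v] u v a' b' unfolding h_def by simp argo
  qed
  have "\<exists>z. h z < ereal (i + 1 / Suc n)" for n :: nat
  proof -
    have "I < ereal (i + 1 / Suc n)" using i by simp
    then show ?thesis unfolding I_def by (simp add: INF_less_iff)
  qed
  then obtain X where X: "h (X n) < ereal (i + 1 / Suc n)" for n
    by metis
  define a where "a n = real_of_ereal (f (X n)) + q (X n)" for n
  have hX: "h (X n) < \<infinity>" for n using X[of n] by (cases "h (X n)") auto
  have ha: "h (X n) = ereal (a n)" for n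
    using fin[OF hX[of n]] unfolding a_def h_def by (metis plus_ereal.simps(1))
  have a1: "i \<le> a n" "a n < i + 1 / Suc n" for n
    using ge[OF hX[of n]] X[of n] unfolding ha by (auto simp: a_def)
  have a_lim: "a \<longlonglongrightarrow> i"
  proof (rule tendsto_sandwich[of "\<lambda>_. i"])
    have "(\<lambda>n. i + 1 / Suc n) \<longlonglongrightarrow> i + 0"
      by (intro tendsto_intros LIMSEQ_Suc lim_1_over_n)
    then show "(\<lambda>n. i + 1 / Suc n) \<longlonglongrightarrow> i" by simp
  qed (use a1 in \<open>auto intro!: always_eventually less_imp_le\<close>)
  have "Cauchy X"
  proof (rule CauchyI)
    fix e :: real assume e: "e > 0"
    then have "0 < c * e\<^sup>2" using c by simp
    then obtain N where N: "inverse (real (Suc N)) < c * e\<^sup>2"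
      using reals_Archimedean by blast
    show "\<exists>N. \<forall>m\<ge>N. \<forall>n\<ge>N. norm (X m - X n) < e"
    proof (intro exI[of _ N] allI impI)
      fix m n assume mn: "m \<ge> N" "n \<ge> N"
      have aN: "a k \<le> i + inverse (real (Suc N))" if "k \<ge> N" for k
      proof -
        have "1 / real (Suc k) \<le> inverse (real (Suc N))"
          using that by (simp add: field_simps)
        with a1(2)[of k] show ?thesis by argo
      qed
      have "c * (norm (X m - X n))\<^sup>2 \<le> (a m + a n) / 2 - i"
        by (rule mid[OF ha ha])
      also have "\<dots> \<le> inverse (real (Suc N))"
        using aN[OF mn(1)] aN[OF mn(2)] by argo
      also note N
      finally have "(norm (X m - X n))\<^sup>2 < e\<^sup>2" using c by simp
      then show "norm (X m - X n) < e"
        using e by (simp add: power2_less_imp_less)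
    qed
  qed
  then obtain p where p: "X \<longlonglongrightarrow> p"
    using Cauchy_convergent convergent_def by blast
  have "isCont q p" using q by (simp add: continuous_on_eq_continuous_at)
  then have "(\<lambda>n. q (X n)) \<longlonglongrightarrow> q p" using p by (rule isCont_tendsto_compose)
  \<comment> \<open>Continuity of \<open>q\<close> splits the limit of the total values, so
    \<open>f\<close> alone converges along \<open>X\<close>.\<close>
  then have "(\<lambda>n. ereal (a n - q (X n))) \<longlonglongrightarrow> ereal (i - q p)"
    using a_lim by (intro tendsto_intros)
  moreover have "f (X n) = ereal (a n - q (X n))" for n
    using fin[OF hX[of n]] by (simp add: a_def)
  ultimately have "f p \<le> ereal (i - q p)"
    using lower_semicontinuous_le_lim[OF f(3) p] by simp
  then have "h p \<le> I"
    unfolding h_def i by (cases "f p") auto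
  then have hp: "h p = I"
    unfolding I_def by (intro antisym INF_lower) auto
  have "argmin h = {p}"
  proof (intro equalityI subsetI)
    fix r assume "r \<in> argmin h"
    then have "h r \<le> h p" by (simp add: argmin_iff)
    then have hr: "h r = I"
      unfolding hp unfolding I_def by (intro antisym INF_lower) auto
    \<comment> \<open>Both values equal \<open>i\<close>, so the right-hand side of
      \<open>mid\<close> vanishes.\<close>
    have "c * (norm (r - p))\<^sup>2 \<le> (i + i) / 2 - i"
      using hr hp i by (intro mid) auto
    then have "(norm (r - p))\<^sup>2 \<le> 0" using c(1) by (simp add: mult_le_0_iff)
    then show "r \<in> {p}" by simp
  next
    fix r assume "r \<in> {p}"
    then show "r \<in> argmin h"
      using hp unfolding I_def by (auto simp: argmin_iff intro: INF_lower)
  qed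
  then show thesis using that unfolding h_def by blast
qed

section \<open>First-order inequalities for the smooth part\<close>

lemma gradient_line_deriv:
  assumes "\<forall>z. GDERIV g z :> grad_g z"
  shows "((\<lambda>\<tau>. g (u + \<tau> *\<^sub>R d)) has_real_derivative (grad_g (u + \<tau> *\<^sub>R d) \<bullet> d)) (at \<tau>)"
proof -
  have "(g has_derivative (\<lambda>h. h \<bullet> grad_g (u + \<tau> *\<^sub>R d))) (at (u + \<tau> *\<^sub>R d))"
    using assms by (simp add: gderiv_def)
  moreover have "((\<lambda>\<tau>. u + \<tau> *\<^sub>R d) has_derivative (\<lambda>h. h *\<^sub>R d)) (at \<tau>)"
    by (auto intro!: derivative_eq_intros)
  ultimately have "((\<lambda>\<tau>. g (u + \<tau> *\<^sub>R d)) has_derivative (\<lambda>h. (h *\<^sub>R d) \<bullet> grad_g (u + \<tau> *\<^sub>R d))) (at \<tau>)"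
    by (rule has_derivative_compose[rotated])
  moreover have "(\<lambda>h. (h *\<^sub>R d) \<bullet> grad_g (u + \<tau> *\<^sub>R d)) = (*) (grad_g (u + \<tau> *\<^sub>R d) \<bullet> d)"
    by (simp add: fun_eq_iff inner_commute mult.commute)
  ultimately show ?thesis
    by (simp add: has_field_derivative_def)
qed

text \<open>Along the segment, \<open>\<phi>\<close> is \<open>g\<close> minus its quadratic model,
  up to a constant. By Cauchy-Schwarz and the Lipschitz bound its derivative is nonpositive on
  [0, 1].\<close>

lemma descent_lemma:
  assumes g: "\<forall>z. GDERIV g z :> grad_g z" and L: "L-lipschitz_on UNIV grad_g"
  shows "g v \<le> g u + grad_g u \<bullet> (v - u) + L / 2 * (norm (v - u))\<^sup>2"
proof -
  define d where "d = v - u"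
  define \<phi> where "\<phi> \<tau> = g (u + \<tau> *\<^sub>R d) - \<tau> * (grad_g u \<bullet> d) - L / 2 * \<tau>\<^sup>2 * (norm d)\<^sup>2" for \<tau>
  have "\<phi> 1 \<le> \<phi> 0"
  proof (rule DERIV_nonpos_imp_nonincreasing[of 0 1 \<phi>])
    fix \<tau> :: real assume \<tau>: "0 \<le> \<tau>" "\<tau> \<le> 1"
    have "(\<phi> has_real_derivative (grad_g (u + \<tau> *\<^sub>R d) \<bullet> d - grad_g u \<bullet> d - L * \<tau> * (norm d)\<^sup>2)) (at \<tau>)"
      unfolding \<phi>_def
      by (auto intro!: derivative_eq_intros gradient_line_deriv[OF g])
    moreover have "grad_g (u + \<tau> *\<^sub>R d) \<bullet> d - grad_g u \<bullet> d - L * \<tau> * (norm d)\<^sup>2 \<le> 0"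
    proof -
      have "grad_g (u + \<tau> *\<^sub>R d) \<bullet> d - grad_g u \<bullet> d = (grad_g (u + \<tau> *\<^sub>R d) - grad_g u) \<bullet> d"
        by (simp add: inner_diff_left)
      also have "\<dots> \<le> norm (grad_g (u + \<tau> *\<^sub>R d) - grad_g u) * norm d"
        by (rule norm_cauchy_schwarz)
      also have "\<dots> \<le> (L * (\<tau> * norm d)) * norm d"
        using lipschitz_onD[OF L, of "u + \<tau> *\<^sub>R d" u] \<tau>
        by (intro mult_right_mono) (auto simp: dist_norm)
      finally show ?thesis by (simp add: power2_eq_square mult_ac)
    qed
    ultimately show "\<exists>y. (\<phi> has_real_derivative y) (at \<tau>) \<and> y \<le> 0"
      by blast
  qed simp
  then show ?thesis by (simp add: \<phi>_def d_def)
qed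

text \<open>Restriction to the line through \<open>u\<close> and \<open>v\<close> reduces this to
  the tangent inequality in one real variable.\<close>

lemma convex_above_gradient:
  fixes g :: "'a::real_inner \<Rightarrow> real"
  assumes cvx: "convex_on UNIV g" and g: "\<forall>z. GDERIV g z :> grad_g z"
  shows "g u + grad_g u \<bullet> (v - u) \<le> g v"
proof -
  have "convex_on UNIV (\<lambda>\<tau>::real. g (u + \<tau> *\<^sub>R (v - u)))"
  proof (rule convex_onI)
    fix \<theta> a b :: real assume "0 < \<theta>" "\<theta> < 1"
    then show "g (u + ((1 - \<theta>) *\<^sub>R a + \<theta> *\<^sub>R b) *\<^sub>R (v - u))
        \<le> (1 - \<theta>) * g (u + a *\<^sub>R (v - u)) + \<theta> * g (u + b *\<^sub>R (v - u))"
      using convex_onD[OF cvx, of \<theta> "u + a *\<^sub>R (v - u)" "u + b *\<^sub>R (v - u)"]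
      by (simp add: algebra_simps)
  qed simp
  from convex_on_imp_above_tangent[OF this, of 0 1 "grad_g u \<bullet> (v - u)"]
  show ?thesis
    using gradient_line_deriv[OF g, of u "v - u" 0] by simp
qed

text \<open>The last term is the exact convexity gap of the squared norm; all strong convexity
  estimates below come from it.\<close>

lemma norm_convex_comb_sq:
  fixes u v :: "'a::real_inner"
  shows "(norm ((1 - \<theta>) *\<^sub>R u + \<theta> *\<^sub>R v))\<^sup>2
    = (1 - \<theta>) * (norm u)\<^sup>2 + \<theta> * (norm v)\<^sup>2 - \<theta> * (1 - \<theta>) * (norm (u - v))\<^sup>2"
  by (simp add: power2_norm_eq_inner algebra_simps inner_commute)

lemma norm_midpoint_sq:
  fixes u v w :: "'a::real_inner"
  shows "(norm ((1/2) *\<^sub>R u + (1/2) *\<^sub>R v - w))\<^sup>2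
    = ((norm (u - w))\<^sup>2 + (norm (v - w))\<^sup>2) / 2 - (norm (u - v))\<^sup>2 / 4"
proof -
  have "(1/2) *\<^sub>R u + (1/2) *\<^sub>R v - w = (1 - 1/2) *\<^sub>R (u - w) + (1/2) *\<^sub>R (v - w)"
    by (simp add: algebra_simps flip: scaleR_left_distrib)
  then show ?thesis
    by (simp only: norm_convex_comb_sq) simp
qed

section \<open>The proximal inequality and a perturbed recurrence\<close>

text \<open>The quadratic term is strongly convex, so moving from the minimizer \<open>p\<close> to
  \<open>u\<close> costs an extra \<open>1 / (2 * s) * |p - u|^2\<close>. Minimality is tested at
  points of the segment near \<open>p\<close>, which avoids subdifferentials.\<close>

lemma argmin_prox_ineq:
  fixes f :: "'a::real_inner \<Rightarrow> ereal"
  assumes f: "proper f" "ereal_convex f" and s: "s > 0"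
    and p: "p \<in> argmin (\<lambda>z. f z + ereal (1 / (2 * s) * (norm (z - w))\<^sup>2))"
    and u: "f u = ereal b"
  obtains a where "f p = ereal a"
    "a + 1 / (2 * s) * (norm (p - w))\<^sup>2 + 1 / (2 * s) * (norm (p - u))\<^sup>2
      \<le> b + 1 / (2 * s) * (norm (u - w))\<^sup>2"
proof -
  define r where "r = 1 / (2 * s)"
  have min: "f p + ereal (r * (norm (p - w))\<^sup>2) \<le> f z + ereal (r * (norm (z - w))\<^sup>2)" for z
    using p by (simp add: argmin_iff r_def)
  have "f p \<noteq> \<infinity>" using min[of u] u by auto
  then obtain a where a: "f p = ereal a"
    using f(1) by (cases "f p") (auto simp: proper_def)
  have key: "a + r * (norm (p - w))\<^sup>2 + r * (1 - \<theta>) * (norm (p - u))\<^sup>2 \<le> b + r * (norm (u - w))\<^sup>2"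
    if l: "0 < \<theta>" "\<theta> < 1" for \<theta> :: real
  proof -
    define z where "z = (1 - \<theta>) *\<^sub>R p + \<theta> *\<^sub>R u"
    have "f z \<le> ereal ((1 - \<theta>) * a + \<theta> * b)"
      unfolding z_def by (rule ereal_convexD[OF f(2) a u l])
    then have "f z + ereal (r * (norm (z - w))\<^sup>2)
        \<le> ereal ((1 - \<theta>) * a + \<theta> * b) + ereal (r * (norm (z - w))\<^sup>2)"
      by (rule add_right_mono)
    from order_trans[OF min this]
    have "a + r * (norm (p - w))\<^sup>2 \<le> (1 - \<theta>) * a + \<theta> * b + r * (norm (z - w))\<^sup>2"
      by (simp add: a)
    moreover have "z - w = (1 - \<theta>) *\<^sub>R (p - w) + \<theta> *\<^sub>R (u - w)"
      by (simp add: z_def algebra_simps)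
    then have "(norm (z - w))\<^sup>2 = (1 - \<theta>) * (norm (p - w))\<^sup>2 + \<theta> * (norm (u - w))\<^sup>2
        - \<theta> * (1 - \<theta>) * (norm (p - u))\<^sup>2"
      by (simp add: norm_convex_comb_sq)
    \<comment> \<open>Every remaining term carries the factor \<theta>, which is then
      cancelled.\<close>
    ultimately have "\<theta> * (a + r * (norm (p - w))\<^sup>2 + r * (1 - \<theta>) * (norm (p - u))\<^sup>2)
        \<le> \<theta> * (b + r * (norm (u - w))\<^sup>2)"
      by (simp add: algebra_simps)
    then show ?thesis using l by simp
  qed
  \<comment> \<open>Letting \<theta> decrease to 0 replaces the factor \<open>1 - \<theta>\<close>
    by 1.\<close>
  have "((\<lambda>\<theta>. a + r * (norm (p - w))\<^sup>2 + r * (1 - \<theta>) * (norm (p - u))\<^sup>2) \<longlongrightarrow>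
      a + r * (norm (p - w))\<^sup>2 + r * (1 - 0) * (norm (p - u))\<^sup>2) (at_right 0)"
    by (intro tendsto_intros)
  moreover have "\<forall>\<^sub>F \<theta> in at_right (0::real). 0 < \<theta> \<and> \<theta> < 1"
    using eventually_at_right_real[of 0 "1::real"] by simp
  then have "\<forall>\<^sub>F \<theta> in at_right 0. a + r * (norm (p - w))\<^sup>2 + r * (1 - \<theta>) * (norm (p - u))\<^sup>2
      \<le> b + r * (norm (u - w))\<^sup>2"
    by (rule eventually_mono) (use key in auto)
  ultimately have "a + r * (norm (p - w))\<^sup>2 + r * (1 - 0) * (norm (p - u))\<^sup>2 \<le> b + r * (norm (u - w))\<^sup>2"
    by (intro tendsto_upperbound) auto
  then show thesis using that a by (simp add: r_def)
qed

text \<open>Each step takes a convex combination of \<open>a k\<close> and \<open>C\<close> and adds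
  \<open>d k\<close>. Hence \<open>max (a N) C\<close> plus the partial sum of \<open>d\<close>
  stays an upper bound, and summability makes it uniform.\<close>

lemma contraction_recurrence_bounded:
  fixes a \<alpha> d :: "nat \<Rightarrow> real"
  assumes rec: "\<And>k. k \<ge> N \<Longrightarrow> a (Suc k) \<le> (1 - \<alpha> k) * a k + \<alpha> k * C + d k"
    and \<alpha>: "\<And>k. k \<ge> N \<Longrightarrow> 0 \<le> \<alpha> k \<and> \<alpha> k \<le> 1"
    and d: "\<And>k. k \<ge> N \<Longrightarrow> 0 \<le> d k" "summable d"
  obtains M where "\<And>k. k \<ge> N \<Longrightarrow> a k \<le> M"
proof -
  define B where "B = max (a N) C"
  have part: "a k \<le> B + (\<Sum>i=N..<k. d i)" if "k \<ge> N" for k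
    using that
  proof (induction k rule: dec_induct)
    case base
    then show ?case by (simp add: B_def)
  next
    case (step k)
    let ?S = "\<Sum>i=N..<k. d i"
    have S: "0 \<le> ?S" using d by (intro sum_nonneg) auto
    have "a (Suc k) \<le> (1 - \<alpha> k) * a k + \<alpha> k * C + d k" using rec step by simp
    also have "\<dots> \<le> (1 - \<alpha> k) * (B + ?S) + \<alpha> k * (B + ?S) + d k"
      using \<alpha>[of k] step S by (intro add_right_mono add_mono mult_left_mono) (auto simp: B_def)
    also have "\<dots> = B + (\<Sum>i=N..<Suc k. d i)"
      using step by (simp add: algebra_simps)
    finally show ?case .
  qed
  have "summable (\<lambda>i. d (i + N))" using d(2) by (rule summable_ignore_initial_segment)
  then have tail: "(\<Sum>i<n. d (i + N)) \<le> (\<Sum>i. d (i + N))" for n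
    by (rule sum_le_suminf) (use d in auto)
  have "a k \<le> B + (\<Sum>i. d (i + N))" if "k \<ge> N" for k
  proof -
    have "(\<Sum>i=N..<k. d i) = (\<Sum>i<k-N. d (i + N))"
      using sum.shift_bounds_nat_ivl[of d 0 N "k - N"] that by (simp add: atLeast0LessThan)
    then show ?thesis using part[OF that] tail[of "k - N"] by linarith
  qed
  then show thesis by (rule that)
qed


section \<open>Well-definedness of the proximal points and of the regularized minimizers\<close>

lemma finite_at_argmin:
  assumes f: "proper f" and p: "p \<in> argmin (objective f g)"
  obtains c where "f p = ereal c" "\<And>z. ereal (c + g p) \<le> f z + ereal (g z)"
proof -
  from p have le: "f p + ereal (g p) \<le> f z + ereal (g z)" for z
    by (simp add: argmin_iff objective_def)
  from f obtain z where z: "f z \<noteq> \<infinity>" by (auto simp: proper_def)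
  then have "f p \<noteq> \<infinity>" using le[of z] by (cases "f z") auto
  then obtain c where "f p = ereal c"
    using f by (cases "f p") (auto simp: proper_def)
  then show thesis using that le by simp
qed

text \<open>The lower bound needed for existence comes from the minimum of \<open>f + g\<close>:
  \<open>f z\<close> is at least \<open>c + g p - g z\<close>, and \<open>g\<close> grows at most
  with curvature \<open>L\<close>, which is less than \<open>1 / s\<close>.\<close>

lemma argmin_prox:
  fixes f :: "'a::{real_inner, complete_space} \<Rightarrow> ereal"
  assumes f: "proper f" "ereal_convex f" "lower_semicontinuous f"
    and g: "\<forall>z. GDERIV g z :> grad_g z"
    and L: "L-lipschitz_on UNIV grad_g"
    and p: "p \<in> argmin (objective f g)"
    and s: "0 < s" "s * L < 1"
  shows "argmin (\<lambda>z. f z + ereal (1 / (2 * s) * (norm (z - w))\<^sup>2)) = {prox s f w}"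
proof -
  obtain c where c: "f p = ereal c" "\<And>z. ereal (c + g p) \<le> f z + ereal (g z)"
    using finite_at_argmin[OF f(1) p] by blast
  \<comment> \<open>\<kappa> is the curvature left over once the quadratic bound on \<open>g\<close>
    is absorbed; \<open>m\<close> is what remains after completing the square with it.\<close>
  define \<kappa> where "\<kappa> = 1 / (2 * s) - L / 2"
  have \<kappa>: "\<kappa> > 0" using s by (simp add: \<kappa>_def field_simps)
  define m where "m = c + g p - g w - (norm (grad_g w))\<^sup>2 / (4 * \<kappa>)"
  have below: "ereal m \<le> f z + ereal (1 / (2 * s) * (norm (z - w))\<^sup>2)" for z
  proof (cases "f z")
    case (real b)
    have "c + g p \<le> b + g z" using c(2)[of z] real by simp
    also have "g z \<le> g w + grad_g w \<bullet> (z - w) + L / 2 * (norm (z - w))\<^sup>2"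
      by (rule descent_lemma[OF g L])
    also have "grad_g w \<bullet> (z - w) \<le> norm (grad_g w) * norm (z - w)"
      by (rule norm_cauchy_schwarz)
    also have "norm (grad_g w) * norm (z - w) \<le> (norm (grad_g w))\<^sup>2 / (4 * \<kappa>) + \<kappa> * (norm (z - w))\<^sup>2"
    proof -
      have "0 \<le> (norm (grad_g w) - 2 * \<kappa> * norm (z - w))\<^sup>2 / (4 * \<kappa>)" using \<kappa> by simp
      also have "\<dots> = (norm (grad_g w))\<^sup>2 / (4 * \<kappa>) - norm (grad_g w) * norm (z - w) + \<kappa> * (norm (z - w))\<^sup>2"
        using \<kappa> by (simp add: power2_eq_square field_simps)
      finally show ?thesis by simp
    qed
    finally have "m \<le> b + (\<kappa> + L / 2) * (norm (z - w))\<^sup>2"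
      by (simp add: m_def algebra_simps)
    then show ?thesis by (simp add: real \<kappa>_def)
  next
    case MInf
    then show ?thesis using f(1) by (simp add: proper_def)
  qed simp
  have mid: "1 / (2 * s) * (norm ((1/2) *\<^sub>R u + (1/2) *\<^sub>R v - w))\<^sup>2
      \<le> (1 / (2 * s) * (norm (u - w))\<^sup>2 + 1 / (2 * s) * (norm (v - w))\<^sup>2) / 2
        - 1 / (8 * s) * (norm (u - v))\<^sup>2" for u v
    unfolding norm_midpoint_sq using s by (simp add: field_simps)
  obtain r where "argmin (\<lambda>z. f z + ereal (1 / (2 * s) * (norm (z - w))\<^sup>2)) = {r}"
    by (rule singleton_argmin_strongly_convex[OF f _ _ mid below])
      (use s in \<open>auto intro!: continuous_intros\<close>)
  then show ?thesis by (simp add: prox_def)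
qed

text \<open>Convexity of \<open>g\<close> and the Tikhonov term give \<open>q\<close> the midpoint
  modulus \<open>\<epsilon> k / 8\<close>; the minimum of \<open>f + g\<close> bounds the objective
  from below.\<close>

lemma argmin_reg_objective:
  fixes f :: "'a::{real_inner, complete_space} \<Rightarrow> ereal"
  assumes f: "proper f" "ereal_convex f" "lower_semicontinuous f"
    and g: "convex_on UNIV g" "\<forall>z. GDERIV g z :> grad_g z"
    and p: "p \<in> argmin (objective f g)"
    and \<epsilon>: "\<epsilon> k > 0"
  shows "argmin (reg_objective f g \<epsilon> k) = {reg_minimizer f g \<epsilon> k}"
proof -
  obtain c where c: "f p = ereal c" "\<And>z. ereal (c + g p) \<le> f z + ereal (g z)"
    using finite_at_argmin[OF f(1) p] by blast
  define q where "q z = g z + \<epsilon> k / 2 * (norm z)\<^sup>2" for z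
  have eq: "reg_objective f g \<epsilon> k = (\<lambda>z. f z + ereal (q z))"
    by (simp add: fun_eq_iff reg_objective_def objective_def q_def add.assoc)
  have below: "ereal (c + g p) \<le> f z + ereal (q z)" for z
  proof -
    note c(2)[of z]
    also have "f z + ereal (g z) \<le> f z + ereal (q z)"
      using \<epsilon> by (intro add_left_mono) (simp add: q_def)
    finally show ?thesis .
  qed
  have mid: "q ((1/2) *\<^sub>R u + (1/2) *\<^sub>R v) \<le> (q u + q v) / 2 - \<epsilon> k / 8 * (norm (u - v))\<^sup>2" for u v
  proof -
    have le: "g ((1/2) *\<^sub>R u + (1/2) *\<^sub>R v) \<le> (g u + g v) / 2"
      using convex_onD[OF g(1), of "1/2" u v] by simp
    have eq: "(norm ((1/2) *\<^sub>R u + (1/2) *\<^sub>R v))\<^sup>2 = ((norm u)\<^sup>2 + (norm v)\<^sup>2) / 2 - (norm (u - v))\<^sup>2 / 4"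
      using norm_midpoint_sq[of u v 0] by simp
    show ?thesis using le unfolding q_def eq by argo
  qed
  have "continuous_on UNIV g"
    using g(2) by (auto simp: continuous_on_eq_continuous_at gderiv_def intro: has_derivative_continuous)
  then have "continuous_on UNIV q"
    unfolding q_def by (intro continuous_intros)
  then obtain r where "argmin (\<lambda>z. f z + ereal (q z)) = {r}"
    by (rule singleton_argmin_strongly_convex[OF f _ _ mid below]) (use \<epsilon> in auto)
  then show ?thesis by (simp add: reg_minimizer_def eq)
qed

section \<open>One step of the algorithm\<close>

text \<open>The prox is taken at a gradient step \<open>y - s G\<close>, where \<open>G\<close> is
  the gradient at \<open>y\<close> of \<open>g + e/2 |.|^2\<close>. After expanding the squares in
  the proximal inequality, the descent lemma bounds the smooth part at \<open>p\<close> from above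
  and convexity bounds it at \<open>u\<close> from below.\<close>

lemma forward_backward_ineq:
  fixes f :: "'a::{real_inner, complete_space} \<Rightarrow> ereal" and e :: real
  assumes f: "proper f" "ereal_convex f"
    and g: "convex_on UNIV g" "\<forall>z. GDERIV g z :> grad_g z"
    and L: "L-lipschitz_on UNIV grad_g"
    and s: "0 < s" "s * (L + e) \<le> 1" and e: "e \<ge> 0"
    and p: "p \<in> argmin (\<lambda>z. f z + ereal (1 / (2 * s) * (norm (z - (y - s *\<^sub>R grad_g y - (s * e) *\<^sub>R y)))\<^sup>2))"
    and u: "f u = ereal b"
  obtains a where "f p = ereal a"
    "a + (g p + e / 2 * (norm p)\<^sup>2) + 1 / (2 * s) * (norm (p - u))\<^sup>2
      \<le> b + (g u + e / 2 * (norm u)\<^sup>2) + 1 / (2 * s) * (norm (y - u))\<^sup>2"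
proof -
  define G where "G = grad_g y + e *\<^sub>R y"
  have w: "y - s *\<^sub>R grad_g y - (s * e) *\<^sub>R y = y - s *\<^sub>R G"
    by (simp add: G_def algebra_simps)
  obtain a where a: "f p = ereal a"
    and le: "a + 1 / (2 * s) * (norm (p - (y - s *\<^sub>R G)))\<^sup>2 + 1 / (2 * s) * (norm (p - u))\<^sup>2
      \<le> b + 1 / (2 * s) * (norm (u - (y - s *\<^sub>R G)))\<^sup>2"
    using argmin_prox_ineq[OF f s(1) p u] unfolding w .
  \<comment> \<open>The term \<open>s / 2 * |G|^2\<close> does not depend on \<open>z\<close> and
    cancels between \<open>p\<close> and \<open>u\<close>.\<close>
  have exp: "1 / (2 * s) * (norm (z - (y - s *\<^sub>R G)))\<^sup>2
      = 1 / (2 * s) * (norm (z - y))\<^sup>2 + G \<bullet> (z - y) + s / 2 * (norm G)\<^sup>2" for z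
  proof -
    have "(norm (z - (y - s *\<^sub>R G)))\<^sup>2 = (norm ((z - y) + s *\<^sub>R G))\<^sup>2"
      by (simp add: algebra_simps)
    also have "\<dots> = (norm (z - y))\<^sup>2 + 2 * s * (G \<bullet> (z - y)) + s\<^sup>2 * (norm G)\<^sup>2"
      unfolding power2_norm_eq_inner inner_add_left inner_add_right
      by (simp add: inner_commute power2_eq_square)
    finally show ?thesis using s by (simp add: field_simps power2_eq_square)
  qed
  \<comment> \<open>Exact Taylor expansion of the regularizer at \<open>y\<close>, used at both
    \<open>p\<close> and \<open>u\<close>.\<close>
  have sq: "e / 2 * (norm z)\<^sup>2 = e / 2 * (norm y)\<^sup>2 + (e *\<^sub>R y) \<bullet> (z - y) + e / 2 * (norm (z - y))\<^sup>2" for z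
    by (simp add: power2_norm_eq_inner inner_diff_left inner_diff_right inner_commute algebra_simps)
  have "g p + e / 2 * (norm p)\<^sup>2
      \<le> g y + e / 2 * (norm y)\<^sup>2 + G \<bullet> (p - y) + (L + e) / 2 * (norm (p - y))\<^sup>2"
    using descent_lemma[OF g(2) L, of p y] sq[of p]
    unfolding G_def inner_add_left by argo
  also have "(L + e) / 2 * (norm (p - y))\<^sup>2 \<le> 1 / (2 * s) * (norm (p - y))\<^sup>2"
    using s by (intro mult_right_mono) (simp_all add: field_simps)
  finally have up: "g p + e / 2 * (norm p)\<^sup>2
      \<le> g y + e / 2 * (norm y)\<^sup>2 + G \<bullet> (p - y) + 1 / (2 * s) * (norm (p - y))\<^sup>2"
    by simp
  have "0 \<le> e / 2 * (norm (u - y))\<^sup>2" using e by simp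
  then have low: "g y + e / 2 * (norm y)\<^sup>2 + G \<bullet> (u - y) \<le> g u + e / 2 * (norm u)\<^sup>2"
    using convex_above_gradient[OF g, of y u] sq[of u]
    unfolding G_def inner_add_left by linarith
  show thesis
    using that[OF a] le up low unfolding exp by (simp add: norm_minus_commute)
qed

text \<open>To be read with \<open>\<tau> = t k\<close>, \<open>\<sigma> = t (k - 1)\<close>,
  \<open>\<beta> = \<alpha> k\<close>, \<open>e = \<epsilon> k\<close> and
  \<open>p = x (k + 1)\<close>. The forward-backward inequality at \<open>u\<close> is multiplied by
  \<open>\<tau>^2\<close>: the gap at \<open>x\<close> then has the coefficient
  \<open>\<tau>^2 - \<tau> = (1 - \<beta>) \<sigma>^2\<close>.\<close>

lemma energy_step:
  fixes f :: "'a::{real_inner, complete_space} \<Rightarrow> ereal" and g :: "'a \<Rightarrow> real" and e :: real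
  defines "G \<equiv> \<lambda>z. g z + e / 2 * (norm z)\<^sup>2"
  assumes f: "proper f" "ereal_convex f"
    and g: "convex_on UNIV g" "\<forall>z. GDERIV g z :> grad_g z"
    and L: "L-lipschitz_on UNIV grad_g"
    and s: "0 < s" "s * (L + e) \<le> 1" and e: "e \<ge> 0"
    and p: "p \<in> argmin (\<lambda>z. f z + ereal (1 / (2 * s) * (norm (z - (y - s *\<^sub>R grad_g y - (s * e) *\<^sub>R y)))\<^sup>2))"
    and x: "f x = ereal a" and w: "f w = ereal c"
    and \<tau>: "\<tau> > 1" "\<tau>\<^sup>2 - \<tau> = (1 - \<beta>) * \<sigma>\<^sup>2" and \<beta>: "0 \<le> \<beta>" "\<beta> \<le> 1"
    and y: "\<tau> *\<^sub>R y = (\<tau> - 1) *\<^sub>R x + (1 - \<beta>) *\<^sub>R z"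
  obtains b where "f p = ereal b"
    "\<tau>\<^sup>2 * (b + G p - (c + G w)) + 1 / (2 * s) * (norm (x + \<tau> *\<^sub>R (p - x) - w))\<^sup>2
      \<le> (1 - \<beta>) * (\<sigma>\<^sup>2 * (a + G x - (c + G w)) + 1 / (2 * s) * (norm (z - w))\<^sup>2)
        + \<beta> * (1 / (2 * s) * (norm w)\<^sup>2)"
proof -
  define u where "u = (1 - 1/\<tau>) *\<^sub>R x + (1/\<tau>) *\<^sub>R w"
  have t1: "0 < 1/\<tau>" "1/\<tau> < 1" using \<tau> by auto
  have "f u \<le> ereal ((1 - 1/\<tau>) * a + (1/\<tau>) * c)"
    unfolding u_def by (rule ereal_convexD[OF f(2) x w t1])
  then obtain b' where b': "f u = ereal b'" "b' \<le> (1 - 1/\<tau>) * a + (1/\<tau>) * c"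
    using f(1) by (cases "f u") (auto simp: proper_def)
  have Gu: "G u \<le> (1 - 1/\<tau>) * G x + (1/\<tau>) * G w"
  proof -
    have "g u \<le> (1 - 1/\<tau>) * g x + (1/\<tau>) * g w"
      unfolding u_def using t1 by (intro convex_onD[OF g(1)]) auto
    moreover have "0 \<le> (1/\<tau>) * (1 - 1/\<tau>) * (norm (x - w))\<^sup>2"
      using t1 by simp
    then have "(norm u)\<^sup>2 \<le> (1 - 1/\<tau>) * (norm x)\<^sup>2 + (1/\<tau>) * (norm w)\<^sup>2"
      unfolding u_def norm_convex_comb_sq by linarith
    then have "e / 2 * (norm u)\<^sup>2 \<le> e / 2 * ((1 - 1/\<tau>) * (norm x)\<^sup>2 + (1/\<tau>) * (norm w)\<^sup>2)"
      using e by (intro mult_left_mono) auto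
    ultimately show ?thesis unfolding G_def by argo
  qed
  obtain b where b: "f p = ereal b"
    and le: "b + G p + 1 / (2 * s) * (norm (p - u))\<^sup>2 \<le> b' + G u + 1 / (2 * s) * (norm (y - u))\<^sup>2"
    using forward_backward_ineq[OF f g L s e p b'(1)] unfolding G_def .
  have tu: "\<tau> *\<^sub>R u = (\<tau> - 1) *\<^sub>R x + w"
    using \<tau>(1) by (simp add: u_def scaleR_right_distrib right_diff_distrib)
  have np: "\<tau>\<^sup>2 * (norm (p - u))\<^sup>2 = (norm (x + \<tau> *\<^sub>R (p - x) - w))\<^sup>2"
  proof -
    have "\<tau> *\<^sub>R (p - u) = x + \<tau> *\<^sub>R (p - x) - w"
      using tu by (simp add: algebra_simps)
    then show ?thesis
      by (metis norm_scaleR power_mult_distrib power2_abs)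
  qed
  have ny: "\<tau>\<^sup>2 * (norm (y - u))\<^sup>2 \<le> (1 - \<beta>) * (norm (z - w))\<^sup>2 + \<beta> * (norm w)\<^sup>2"
  proof -
    \<comment> \<open>The scaled difference \<open>(1 - \<beta>) z - w\<close> is a convex
      combination of \<open>z - w\<close> and \<open>-w\<close>; the latter produces the term in
      \<open>|w|^2\<close>.\<close>
    have "\<tau> *\<^sub>R (y - u) = (1 - \<beta>) *\<^sub>R (z - w) + \<beta> *\<^sub>R (- w)"
      unfolding scaleR_diff_right[of \<tau>] tu y by (simp add: algebra_simps)
    then have "\<tau>\<^sup>2 * (norm (y - u))\<^sup>2 = (norm ((1 - \<beta>) *\<^sub>R (z - w) + \<beta> *\<^sub>R (- w)))\<^sup>2"
      by (metis norm_scaleR power_mult_distrib power2_abs)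
    moreover have "0 \<le> \<beta> * (1 - \<beta>) * (norm (z - w - - w))\<^sup>2" using \<beta> by simp
    ultimately show ?thesis
      unfolding norm_convex_comb_sq norm_minus_cancel by linarith
  qed
  have "\<tau>\<^sup>2 * (b + G p + 1 / (2 * s) * (norm (p - u))\<^sup>2)
      \<le> \<tau>\<^sup>2 * ((1 - 1/\<tau>) * (a + G x) + (1/\<tau>) * (c + G w) + 1 / (2 * s) * (norm (y - u))\<^sup>2)"
    using le b'(2) Gu by (intro mult_left_mono) (auto simp: algebra_simps)
  also have "\<dots> = (\<tau>\<^sup>2 - \<tau>) * (a + G x) + \<tau> * (c + G w) + 1 / (2 * s) * (\<tau>\<^sup>2 * (norm (y - u))\<^sup>2)"
    using \<tau>(1) by (simp add: power2_eq_square algebra_simps)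
  also have "1 / (2 * s) * (\<tau>\<^sup>2 * (norm (y - u))\<^sup>2)
      \<le> 1 / (2 * s) * ((1 - \<beta>) * (norm (z - w))\<^sup>2 + \<beta> * (norm w)\<^sup>2)"
    using ny s by (intro mult_left_mono) auto
  finally have "\<tau>\<^sup>2 * (b + G p - (c + G w)) + 1 / (2 * s) * (\<tau>\<^sup>2 * (norm (p - u))\<^sup>2)
      \<le> (\<tau>\<^sup>2 - \<tau>) * (a + G x - (c + G w)) + 1 / (2 * s) * ((1 - \<beta>) * (norm (z - w))\<^sup>2 + \<beta> * (norm w)\<^sup>2)"
    by (simp add: algebra_simps)
  then show thesis
    using that[OF b] unfolding np \<tau>(2) by (simp add: algebra_simps diff_divide_distrib)
qed

section \<open>The parameter sequences\<close>

text \<open>The upper bound on \<open>t k\<close> is the positive root of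
  \<open>X^2 - X = t (k - 1)^2\<close>, which gives positivity; \<open>t k > 1\<close> gives the
  bound by 1.\<close>

lemma alpha_seq_bounds:
  assumes t: "1 \<le> t (k - 1)" "t (k - 1) < t k" "t k < (1 + sqrt (1 + 4 * (t (k - 1))\<^sup>2)) / 2"
  shows "0 < alpha_seq t k" "alpha_seq t k < 1"
    and "(t k)\<^sup>2 - t k = (1 - alpha_seq t k) * (t (k - 1))\<^sup>2"
proof -
  have pos: "0 < (t (k - 1))\<^sup>2" using t by simp
  show eq: "(t k)\<^sup>2 - t k = (1 - alpha_seq t k) * (t (k - 1))\<^sup>2"
    using pos by (simp add: alpha_seq_def field_simps)
  have "(2 * t k - 1)\<^sup>2 < (sqrt (1 + 4 * (t (k - 1))\<^sup>2))\<^sup>2"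
    using t by (intro power_strict_mono) auto
  then have "(t k)\<^sup>2 - t k < (t (k - 1))\<^sup>2"
    by (simp add: power2_eq_square algebra_simps)
  then show "0 < alpha_seq t k"
    unfolding eq using pos by (simp add: algebra_simps zero_less_mult_iff)
  have "0 < t k * (t k - 1)" using t by (intro mult_pos_pos) auto
  then have "0 < (t k)\<^sup>2 - t k" by (simp add: power2_eq_square algebra_simps)
  then show "alpha_seq t k < 1"
    unfolding eq using pos by (simp add: zero_less_mult_iff)
qed

text \<open>Any real number above the limsup serves as \<open>C\<close>. This brings the limsup
  conditions into the form used by the recurrence.\<close>

lemma eventually_le_mult_of_limsup_divide:
  fixes a \<alpha> :: "nat \<Rightarrow> real"
  assumes "limsup (\<lambda>k. ereal (a k / \<alpha> k)) < \<infinity>" and "\<forall>\<^sub>F k in sequentially. 0 < \<alpha> k"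
  obtains C where "\<forall>\<^sub>F k in sequentially. a k \<le> \<alpha> k * C"
proof -
  obtain C where "limsup (\<lambda>k. ereal (a k / \<alpha> k)) < ereal C"
    using assms(1) by (meson ereal_dense2)
  then have "\<forall>\<^sub>F k in sequentially. ereal (a k / \<alpha> k) < ereal C"
    by (rule Limsup_lessD)
  with assms(2) have "\<forall>\<^sub>F k in sequentially. a k \<le> \<alpha> k * C"
    by eventually_elim (simp add: field_simps)
  then show thesis by (rule that)
qed

text \<open>The differences are extended reals and \<open>f\<close> may be infinite at
  \<open>x 0\<close> and \<open>x 1\<close>, so each estimate asks for real sequences that agree
  with the difference from some index on.\<close>

theorem theorem6:
  fixes f :: "'a::{real_inner, complete_space} \<Rightarrow> ereal"
    and g :: "'a \<Rightarrow> real" and grad_g :: "'a \<Rightarrow> 'a"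
    and L s :: real and t \<epsilon> :: "nat \<Rightarrow> real"
    and x y :: "nat \<Rightarrow> 'a" and k0 :: nat
  assumes f: "proper f" "ereal_convex f" "lower_semicontinuous f"
    and g: "convex_on UNIV g" "\<forall>z. GDERIV g z :> grad_g z" "continuous_on UNIV grad_g"
    and L: "L > 0" "L-lipschitz_on UNIV grad_g"
    and min_ex: "argmin (objective f g) \<noteq> {}"
    and t0: "t 0 = 1"
    and t: "\<forall>k\<ge>1. t (k - 1) < t k \<and> t k < (1 + sqrt (1 + 4 * (t (k - 1))\<^sup>2)) / 2"
    and eps: "\<forall>k\<ge>1. \<epsilon> k > 0" "\<forall>k\<ge>1. \<epsilon> (k + 1) \<le> \<epsilon> k" "\<epsilon> \<longlonglongrightarrow> 0"
    and s: "0 < s" "s < 1 / L"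
    and y: "\<forall>k\<ge>1. y k = x k
              + ((t k - 1) * (t (k - 1) - 1) / (t (k - 1))\<^sup>2) *\<^sub>R (x k - x (k - 1))
              - ((- (t k)\<^sup>2 + t k + (t (k - 1))\<^sup>2) / ((t (k - 1))\<^sup>2 * t k)) *\<^sub>R x k"
    and x: "\<forall>k\<ge>1. x (k + 1) = prox s f (y k - s *\<^sub>R grad_g (y k) - (s * \<epsilon> k) *\<^sub>R y k)"
    and k0: "k0 \<ge> 1" "s \<in> {0<..1 / (L + \<epsilon> k0)}"
    and cases:
      "(filterlim (pi_seq t k0) at_top sequentially
          \<and> limsup (\<lambda>k. ereal ((t k)\<^sup>2 * (\<epsilon> k - \<epsilon> (k + 1)) / alpha_seq t k)) < \<infinity>
          \<and> limsup (\<lambda>k. ereal (t k * \<epsilon> k / alpha_seq t k)) < \<infinity>)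
       \<or> (convergent (pi_seq t k0)
          \<and> summable (\<lambda>k. (t (k + 1))\<^sup>2 * (\<epsilon> (k + 1) - \<epsilon> (k + 2)))
          \<and> summable (\<lambda>k. t (k + 1) * \<epsilon> (k + 1)))"
  shows "(\<exists>u \<in> O(\<lambda>k. 1 / (t (k - 1))\<^sup>2). \<forall>\<^sub>F k in sequentially.
            reg_objective f g \<epsilon> k (x k) - reg_objective f g \<epsilon> k (reg_minimizer f g \<epsilon> k) = ereal (u k))
       \<and> (\<exists>u \<in> O(\<lambda>k. 1 / (t (k - 1))\<^sup>2). \<exists>v \<in> O(\<epsilon>). \<forall>\<^sub>F k in sequentially.
            objective f g (x k) - (INF z. objective f g z) = ereal (u k + v k))"
proof -
  define \<alpha> where "\<alpha> = alpha_seq t"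
  have t_ge: "1 \<le> t k" for k
  proof (induction k)
    case (Suc k)
    then show ?case using t[rule_format, of "Suc k"] by simp
  qed (simp add: t0)
  have t_less: "t (k - 1) < t k" if "k \<ge> 1" for k using t that by blast
  have t_gt: "1 < t k" if "k \<ge> 1" for k
    using t_less[OF that] t_ge[of "k - 1"] by linarith
  have \<alpha>: "0 < \<alpha> k" "\<alpha> k < 1" "(t k)\<^sup>2 - t k = (1 - \<alpha> k) * (t (k - 1))\<^sup>2" if "k \<ge> 1" for k
    using alpha_seq_bounds[of t k] t_ge t that unfolding \<alpha>_def by blast+
  have \<alpha>_pos: "\<forall>\<^sub>F k in sequentially. 0 < alpha_seq t k"
    using \<alpha>(1) unfolding \<alpha>_def by (rule eventually_sequentiallyI)

  \<comment> \<open>A minimizer, and finiteness of \<open>f\<close> along the iterates\<close>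
  obtain w where w: "w \<in> argmin (objective f g)" using min_ex by blast
  obtain c where c: "f w = ereal c" "\<And>z. ereal (c + g w) \<le> f z + ereal (g z)"
    using finite_at_argmin[OF f(1) w] by blast
  have sL: "s * L < 1" using s L(1) by (simp add: field_simps)
  have xp: "x (Suc k) \<in> argmin (\<lambda>z. f z + ereal (1 / (2 * s) *
      (norm (z - (y k - s *\<^sub>R grad_g (y k) - (s * \<epsilon> k) *\<^sub>R y k)))\<^sup>2))" if "k \<ge> 1" for k
    using argmin_prox[OF f g(2) L(2) w s(1) sL] x that by simp
  \<comment> \<open>The real value is meaningful from index 2 on: \<open>x 2\<close> is the first
    point known to be a proximal point.\<close>
  define a where "a k = real_of_ereal (f (x k))" for k
  have a: "f (x k) = ereal (a k)" if k: "k \<ge> 2" for k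
  proof -
    obtain j where j: "k = Suc j" "j \<ge> 1" using k by (cases k) auto
    show ?thesis
      unfolding a_def j(1) using argmin_prox_ineq[OF f(1,2) s(1) xp[OF j(2)] c(1)]
      by (metis real_of_ereal.simps(1))
  qed

  \<comment> \<open>The auxiliary sequence and the step size\<close>
  define z where "z k = x (k - 1) + t (k - 1) *\<^sub>R (x k - x (k - 1))" for k
  have ty: "t k *\<^sub>R y k = (t k - 1) *\<^sub>R x k + (1 - \<alpha> k) *\<^sub>R z k" if k: "k \<ge> 1" for k
  proof -
    define \<sigma> where "\<sigma> = t (k - 1)"
    have pos: "\<sigma> > 0" "t k > 0" using t_ge[of "k - 1"] t_ge[of k] by (auto simp: \<sigma>_def)
    have "t k * ((t k - 1) * (\<sigma> - 1) / \<sigma>\<^sup>2) = ((t k)\<^sup>2 - t k) * (\<sigma> - 1) / \<sigma>\<^sup>2"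
      by (simp add: power2_eq_square algebra_simps)
    also have "\<dots> = (1 - \<alpha> k) * (\<sigma> - 1)"
      using \<alpha>(3)[OF k] pos by (simp add: \<sigma>_def)
    finally have 1: "t k * ((t k - 1) * (\<sigma> - 1) / \<sigma>\<^sup>2) = (1 - \<alpha> k) * (\<sigma> - 1)" .
    have 2: "t k * ((- (t k)\<^sup>2 + t k + \<sigma>\<^sup>2) / (\<sigma>\<^sup>2 * t k)) = \<alpha> k"
      using pos by (simp add: \<alpha>_def alpha_seq_def \<sigma>_def)
    have "t k *\<^sub>R y k = t k *\<^sub>R x k + ((1 - \<alpha> k) * (\<sigma> - 1)) *\<^sub>R (x k - x (k - 1)) - \<alpha> k *\<^sub>R x k"
      using y[rule_format, OF k] unfolding \<sigma>_def[symmetric]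
      by (simp only: scaleR_add_right scaleR_diff_right[of "t k" "_ + _"] scaleR_scaleR 1 2)
    then show ?thesis
      by (simp add: z_def \<sigma>_def algebra_simps)
  qed
  have eps_dec: "\<epsilon> k \<le> \<epsilon> j" if "1 \<le> j" "j \<le> k" for j k
    using that(2)
  proof (induction k rule: dec_induct)
    case (step n)
    then show ?case using eps(2)[rule_format, of n] that(1) by simp
  qed simp
  \<comment> \<open>The step-size condition at \<open>k0\<close> persists since \<epsilon> does not
    increase.\<close>
  have sLe: "s * (L + \<epsilon> k) \<le> 1" if "k \<ge> k0" for k
  proof -
    have "s * (L + \<epsilon> k) \<le> s * (L + \<epsilon> k0)"
      using eps_dec[of k0 k] that k0 s by (intro mult_left_mono) auto
    also have "\<dots> \<le> 1"
      using k0 L(1) eps(1) by (auto simp: field_simps add_pos_pos)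
    finally show ?thesis .
  qed

  \<comment> \<open>The energy recurrence\<close>
  define D where "D k = a k + (g (x k) + \<epsilon> k / 2 * (norm (x k))\<^sup>2) - (c + (g w + \<epsilon> k / 2 * (norm w)\<^sup>2))" for k
  define E where "E k = (t (k - 1))\<^sup>2 * D k + 1 / (2 * s) * (norm (z k - w))\<^sup>2" for k
  define \<delta> where "\<delta> k = (t k)\<^sup>2 * (\<epsilon> k - \<epsilon> (k + 1))" for k
  have \<delta>_nonneg: "0 \<le> \<delta> k" if "k \<ge> 1" for k
    using eps(2) that by (simp add: \<delta>_def)
  have E_step: "E (Suc k) \<le> (1 - \<alpha> k) * E k + \<alpha> k * (1 / (2 * s) * (norm w)\<^sup>2) + (norm w)\<^sup>2 / 2 * \<delta> k"
    if k: "k \<ge> 2" "k \<ge> k0" for k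
  proof -
    have k1: "k \<ge> 1" using k by simp
    \<comment> \<open>\<open>X\<close> is \<open>D (Suc k)\<close> with \<open>\<epsilon> k\<close>
      in place of \<open>\<epsilon> (Suc k)\<close>. Exchanging the two costs only a term in
      \<open>|w|^2\<close>, as the one in \<open>x (Suc k)\<close> has a favourable sign.\<close>
    define X where "X = a (Suc k) + (g (x (Suc k)) + \<epsilon> k / 2 * (norm (x (Suc k)))\<^sup>2)
      - (c + (g w + \<epsilon> k / 2 * (norm w)\<^sup>2))"
    obtain b where b: "f (x (Suc k)) = ereal b"
      and le: "(t k)\<^sup>2 * (b + (g (x (Suc k)) + \<epsilon> k / 2 * (norm (x (Suc k)))\<^sup>2) - (c + (g w + \<epsilon> k / 2 * (norm w)\<^sup>2)))
        + 1 / (2 * s) * (norm (x k + t k *\<^sub>R (x (Suc k) - x k) - w))\<^sup>2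
      \<le> (1 - \<alpha> k) * E k + \<alpha> k * (1 / (2 * s) * (norm w)\<^sup>2)"
      using energy_step[OF f(1,2) g(1,2) L(2) s(1) sLe[OF k(2)] less_imp_le[OF eps(1)[rule_format, OF k1]]
          xp[OF k1] a[OF k(1)] c(1) t_gt[OF k1] \<alpha>(3)[OF k1] less_imp_le[OF \<alpha>(1)[OF k1]]
          less_imp_le[OF \<alpha>(2)[OF k1]] ty[OF k1]]
      unfolding E_def D_def by blast
    have "b = a (Suc k)" using a[of "Suc k"] b k by simp
    then have "(t k)\<^sup>2 * X + 1 / (2 * s) * (norm (z (Suc k) - w))\<^sup>2
        \<le> (1 - \<alpha> k) * E k + \<alpha> k * (1 / (2 * s) * (norm w)\<^sup>2)"
      using le by (simp add: X_def z_def)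
    moreover have "(t k)\<^sup>2 * D (Suc k) \<le> (t k)\<^sup>2 * X + (norm w)\<^sup>2 / 2 * \<delta> k"
    proof -
      have "0 \<le> (\<epsilon> k - \<epsilon> (k + 1)) * ((norm (x (Suc k)))\<^sup>2 / 2)"
        using eps(2) k1 by simp
      then have "D (Suc k) \<le> X + (\<epsilon> k - \<epsilon> (k + 1)) * ((norm w)\<^sup>2 / 2)"
        by (simp add: D_def X_def field_simps)
      then have "(t k)\<^sup>2 * D (Suc k) \<le> (t k)\<^sup>2 * (X + (\<epsilon> k - \<epsilon> (k + 1)) * ((norm w)\<^sup>2 / 2))"
        by (intro mult_left_mono) auto
      then show ?thesis by (simp add: \<delta>_def algebra_simps diff_divide_distrib)
    qed
    ultimately show ?thesis
      by (simp add: E_def[of "Suc k"])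
  qed

  \<comment> \<open>Perturbation terms under the two sets of conditions\<close>
  \<comment> \<open>A common form for both alternatives: (a) yields it with
    \<open>d = d' = 0\<close>, (b) with \<open>C = C' = 0\<close>.\<close>
  have "\<exists>C d N. summable d \<and> (\<forall>k\<ge>N. 0 \<le> d k \<and> \<delta> k \<le> \<alpha> k * C + d k)
      \<and> (\<exists>C' d'. summable d' \<and> (\<forall>k\<ge>N. 0 \<le> d' k \<and> t k * \<epsilon> k \<le> \<alpha> k * C' + d' k))"
    using cases
  proof (elim disjE conjE)
    assume lim: "limsup (\<lambda>k. ereal ((t k)\<^sup>2 * (\<epsilon> k - \<epsilon> (k + 1)) / alpha_seq t k)) < \<infinity>"
      "limsup (\<lambda>k. ereal (t k * \<epsilon> k / alpha_seq t k)) < \<infinity>"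
    obtain C where "\<forall>\<^sub>F k in sequentially. \<delta> k \<le> \<alpha> k * C"
      unfolding \<delta>_def \<alpha>_def using eventually_le_mult_of_limsup_divide[OF lim(1) \<alpha>_pos] by blast
    moreover obtain C' where "\<forall>\<^sub>F k in sequentially. t k * \<epsilon> k \<le> \<alpha> k * C'"
      unfolding \<alpha>_def using eventually_le_mult_of_limsup_divide[OF lim(2) \<alpha>_pos] by blast
    ultimately have "\<forall>\<^sub>F k in sequentially. \<delta> k \<le> \<alpha> k * C \<and> t k * \<epsilon> k \<le> \<alpha> k * C'"
      by (rule eventually_conj)
    then obtain N where "\<forall>k\<ge>N. \<delta> k \<le> \<alpha> k * C \<and> t k * \<epsilon> k \<le> \<alpha> k * C'"
      by (auto simp: eventually_sequentially)
    then show ?thesis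
      by (intro exI[of _ C] exI[of _ "\<lambda>_. 0"] exI[of _ N] conjI exI[of _ C']) auto
  next
    assume sum: "summable (\<lambda>k. (t (k + 1))\<^sup>2 * (\<epsilon> (k + 1) - \<epsilon> (k + 2)))"
      "summable (\<lambda>k. t (k + 1) * \<epsilon> (k + 1))"
    have "summable \<delta>"
      using sum(1) unfolding summable_iff_shift[of \<delta> 1, symmetric] by (simp add: \<delta>_def)
    moreover have "summable (\<lambda>k. t k * \<epsilon> k)"
      using sum(2) unfolding summable_iff_shift[of "\<lambda>k. t k * \<epsilon> k" 1, symmetric] .
    moreover have "0 \<le> t k * \<epsilon> k" if "k \<ge> 1" for k
      using t_ge[of k] eps(1) that by (simp add: less_imp_le)
    ultimately show ?thesis
      using \<delta>_nonneg
      by (intro exI[of _ "0::real"] exI[of _ \<delta>] exI[of _ 1] conjI exI[of _ "\<lambda>k. t k * \<epsilon> k"]) auto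
  qed
  then obtain C d N0 C' d' where d: "summable d" "\<And>k. k \<ge> N0 \<Longrightarrow> 0 \<le> d k"
      "\<And>k. k \<ge> N0 \<Longrightarrow> \<delta> k \<le> \<alpha> k * C + d k"
    and d': "summable d'" "\<And>k. k \<ge> N0 \<Longrightarrow> 0 \<le> d' k"
      "\<And>k. k \<ge> N0 \<Longrightarrow> t k * \<epsilon> k \<le> \<alpha> k * C' + d' k"
    by blast

  \<comment> \<open>Boundedness of the energy and of \<open>t k^2 * \<epsilon> k\<close>\<close>
  define N where "N = max N0 (max 2 k0)"
  obtain M where M: "\<And>k. k \<ge> N \<Longrightarrow> E k \<le> M"
  proof (rule contraction_recurrence_bounded)
    fix k assume k: "k \<ge> N"
    have "(norm w)\<^sup>2 / 2 * \<delta> k \<le> (norm w)\<^sup>2 / 2 * (\<alpha> k * C + d k)"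
      using d(3)[of k] k by (intro mult_left_mono) (auto simp: N_def)
    with E_step[of k] k
    show "E (Suc k) \<le> (1 - \<alpha> k) * E k + \<alpha> k * (1 / (2 * s) * (norm w)\<^sup>2 + (norm w)\<^sup>2 / 2 * C)
        + (norm w)\<^sup>2 / 2 * d k"
      by (simp add: N_def algebra_simps)
    show "0 \<le> \<alpha> k \<and> \<alpha> k \<le> 1" using \<alpha>(1,2)[of k] k by (simp add: N_def)
    show "0 \<le> (norm w)\<^sup>2 / 2 * d k" using d(2)[of k] k by (simp add: N_def)
  next
    show "summable (\<lambda>k. (norm w)\<^sup>2 / 2 * d k)" using d(1) by (rule summable_mult)
  qed blast
  \<comment> \<open>The shifted index matches the factor \<open>1 - \<alpha> k\<close>, through
    \<open>t k^2 = (1 - \<alpha> k) t (k - 1)^2 + t k\<close>. Since \<open>k\<close> is at least 2,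
    the unconstrained value \<open>\<epsilon> 0\<close> does not occur.\<close>
  obtain M' where M': "\<And>k. k \<ge> N \<Longrightarrow> (t (k - 1))\<^sup>2 * \<epsilon> (k - 1) \<le> M'"
  proof (rule contraction_recurrence_bounded[of N "\<lambda>k. (t (k - 1))\<^sup>2 * \<epsilon> (k - 1)" \<alpha> C' d'])
    fix k assume k: "k \<ge> N"
    then have k1: "k \<ge> 1" "k \<ge> 2" "k \<ge> N0" by (auto simp: N_def)
    have "(t k)\<^sup>2 * \<epsilon> k = ((1 - \<alpha> k) * (t (k - 1))\<^sup>2) * \<epsilon> k + t k * \<epsilon> k"
      unfolding \<alpha>(3)[OF k1(1), symmetric] by (simp add: algebra_simps)
    also have "\<dots> \<le> ((1 - \<alpha> k) * (t (k - 1))\<^sup>2) * \<epsilon> (k - 1) + (\<alpha> k * C' + d' k)"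
      using d'(3)[OF k1(3)] \<alpha>(2)[OF k1(1)] eps_dec[of "k - 1" k] k1
      by (intro add_mono mult_left_mono) auto
    finally show "(t (Suc k - 1))\<^sup>2 * \<epsilon> (Suc k - 1)
        \<le> (1 - \<alpha> k) * ((t (k - 1))\<^sup>2 * \<epsilon> (k - 1)) + \<alpha> k * C' + d' k"
      by simp
    show "0 \<le> \<alpha> k \<and> \<alpha> k \<le> 1" using \<alpha>(1,2)[OF k1(1)] by simp
    show "0 \<le> d' k" using d'(2)[OF k1(3)] .
  qed (use d' in blast)+

  \<comment> \<open>The two convergence rates\<close>
  define K where "K = M + M' * ((norm w)\<^sup>2 / 2)"
  have D_le: "D k + \<epsilon> k / 2 * (norm w)\<^sup>2 \<le> K * (1 / (t (k - 1))\<^sup>2)" if k: "k \<ge> N" for k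
  proof -
    have k1: "k \<ge> 2" using k by (simp add: N_def)
    have pos: "0 < (t (k - 1))\<^sup>2" using t_ge[of "k - 1"] by simp
    have "(t (k - 1))\<^sup>2 * D k \<le> E k" using s(1) by (simp add: E_def)
    also have "E k \<le> M" using M[OF k] .
    finally have 1: "(t (k - 1))\<^sup>2 * D k \<le> M" .
    have "(t (k - 1))\<^sup>2 * \<epsilon> k \<le> (t (k - 1))\<^sup>2 * \<epsilon> (k - 1)"
      using eps_dec[of "k - 1" k] k1 by (intro mult_left_mono) auto
    also have "\<dots> \<le> M'" using M'[OF k] .
    finally have "(t (k - 1))\<^sup>2 * \<epsilon> k * ((norm w)\<^sup>2 / 2) \<le> M' * ((norm w)\<^sup>2 / 2)"
      by (intro mult_right_mono) auto
    with 1 have "(t (k - 1))\<^sup>2 * (D k + \<epsilon> k / 2 * (norm w)\<^sup>2) \<le> K"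
      by (simp add: K_def algebra_simps)
    then show ?thesis using pos by (simp add: field_simps)
  qed
  \<comment> \<open>\<open>D k\<close> is measured from \<open>F_k(w)\<close>, which exceeds the
    minimum of \<open>f + g\<close> by \<open>\<epsilon> k / 2 * |w|^2\<close>. Both gaps lie
    between 0 and the sum of these two quantities.\<close>
  have bigoK: "u \<in> O(\<lambda>k. 1 / (t (k - 1))\<^sup>2)"
    if "\<And>k. k \<ge> N \<Longrightarrow> 0 \<le> u k" "\<And>k. k \<ge> N \<Longrightarrow> u k \<le> D k + \<epsilon> k / 2 * (norm w)\<^sup>2" for u :: "nat \<Rightarrow> real"
  proof (rule bigoI)
    show "\<forall>\<^sub>F k in sequentially. norm (u k) \<le> K * norm (1 / (t (k - 1))\<^sup>2)"
      using that D_le by (intro eventually_sequentiallyI[of N]) (fastforce intro: order_trans)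
  qed
  define r where "r k = real_of_ereal (reg_objective f g \<epsilon> k (reg_minimizer f g \<epsilon> k))" for k
  have reg_x: "reg_objective f g \<epsilon> k (x k) = ereal (D k + (c + (g w + \<epsilon> k / 2 * (norm w)\<^sup>2)))"
    if "k \<ge> N" for k
    using a[of k] that by (simp add: reg_objective_def objective_def D_def N_def)
  have r: "reg_objective f g \<epsilon> k (reg_minimizer f g \<epsilon> k) = ereal (r k)"
      "c + g w \<le> r k" "r k \<le> D k + (c + (g w + \<epsilon> k / 2 * (norm w)\<^sup>2))" if k: "k \<ge> N" for k
  proof -
    let ?m = "reg_minimizer f g \<epsilon> k"
    have \<epsilon>: "\<epsilon> k > 0" using eps(1) k by (simp add: N_def)
    have up: "reg_objective f g \<epsilon> k ?m \<le> ereal (D k + (c + (g w + \<epsilon> k / 2 * (norm w)\<^sup>2)))"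
      using argmin_reg_objective[of f g grad_g w \<epsilon> k, OF f g(1,2) w \<epsilon>]
      unfolding reg_x[OF k, symmetric] by (metis argmin_iff singletonI)
    have "ereal (c + g w) + 0 \<le> reg_objective f g \<epsilon> k ?m"
      unfolding reg_objective_def objective_def
      using c(2)[of ?m] \<epsilon> by (intro add_mono) auto
    then have low: "ereal (c + g w) \<le> reg_objective f g \<epsilon> k ?m" by simp
    from up low show eq: "reg_objective f g \<epsilon> k ?m = ereal (r k)"
      unfolding r_def by (cases "reg_objective f g \<epsilon> k ?m") auto
    from up low show "c + g w \<le> r k" "r k \<le> D k + (c + (g w + \<epsilon> k / 2 * (norm w)\<^sup>2))"
      unfolding eq by simp_all
  qed
  have inf: "(INF v. objective f g v) = ereal (c + g w)"
  proof (rule antisym)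
    show "(INF v. objective f g v) \<le> ereal (c + g w)"
      by (rule INF_lower2[of w]) (simp_all add: objective_def c(1))
    show "ereal (c + g w) \<le> (INF v. objective f g v)"
      using c(2) by (intro INF_greatest) (simp add: objective_def)
  qed
  define p where "p k = a k + g (x k) - (c + g w)" for k
  have eq1: "\<forall>\<^sub>F k in sequentially. reg_objective f g \<epsilon> k (x k) - reg_objective f g \<epsilon> k (reg_minimizer f g \<epsilon> k)
      = ereal (D k + (c + (g w + \<epsilon> k / 2 * (norm w)\<^sup>2)) - r k)"
    using reg_x r(1) by (intro eventually_sequentiallyI[of N]) simp
  have O1: "(\<lambda>k. D k + (c + (g w + \<epsilon> k / 2 * (norm w)\<^sup>2)) - r k) \<in> O(\<lambda>k. 1 / (t (k - 1))\<^sup>2)"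
    using r(2,3) by (intro bigoK) (auto simp: algebra_simps)
  \<comment> \<open>The summand 0 is the witness for \<open>v\<close>.\<close>
  have eq2: "\<forall>\<^sub>F k in sequentially. objective f g (x k) - (INF v. objective f g v) = ereal (p k + 0)"
    unfolding inf using a
    by (intro eventually_sequentiallyI[of 2]) (simp add: objective_def p_def)
  have O2: "p \<in> O(\<lambda>k. 1 / (t (k - 1))\<^sup>2)"
  proof (rule bigoK)
    fix k assume k: "k \<ge> N"
    then have k2: "k \<ge> 2" by (simp add: N_def)
    show "0 \<le> p k" using c(2)[of "x k"] a[OF k2] by (simp add: p_def)
    have "0 \<le> \<epsilon> k / 2 * (norm (x k))\<^sup>2" using eps(1) k2 by (simp add: less_imp_le)
    then show "p k \<le> D k + \<epsilon> k / 2 * (norm w)\<^sup>2" by (simp add: p_def D_def)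
  qed
  have O0: "(\<lambda>_. 0) \<in> O(\<epsilon>)" by simp
  show ?thesis
    by (rule conjI[OF bexI[OF _ O1] bexI[OF bexI[OF _ O0] O2]]) (rule eq1, rule eq2)
qed

end
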